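(* Let $a,b$ be positive integers, and let $g_{a,b}(3)$ denote the least positive integer $g$ such that every element of $LQ_{a,b}^3$ can be written as a sum of at most $g$ cubes of elements of $LQ_{a,b}$. Then such a $g$ exists, and: (i) if $3 \nmid a$ or $3 \nmid b$, then $3 \leq g_{a,b}(3) \leq 6$; (ii) if $3 \mid a$ and $3 \mid b$, then $4 \leq g_{a,b}(3) \leq 5$.
   Context: For integers $a,b$, $LQ_{a,b}$ denotes the quaternion ring $\{\alpha_0 + \alpha_1 \mathbf{i} + \alpha_2 \mathbf{j} + \alpha_3 \mathbf{k} \mid \alpha_n \in \mathbb{Z}\}$ with multiplication determined by $\mathbf{i}^2 = -a$, $\mathbf{j}^2 = -b$, $\mathbf{i}\mathbf{j} = -\mathbf{j}\mathbf{i} = \mathbf{k}$ (so $\mathbf{k}^2=-ab$). $LQ_{a,b}^3$ denotes the additive subgroup of $LQ_{a,b}$ generated by all cubes $x^3$, $x \in LQ_{a,b}$. *)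

theory Defs
  imports "HOL-Algebra.Ring" "HOL-Algebra.Generated_Groups"
begin

datatype quat = Quat (qre: int) (qi: int) (qj: int) (qk: int)

text \<open>
  The product is the bilinear extension of \<open>i\<^sup>2 = -a\<close>, \<open>j\<^sup>2 = -b\<close>, \<open>ij = -ji = k\<close>, which by
  associativity force \<open>k\<^sup>2 = -ab\<close>, \<open>jk = -kj = bi\<close> and \<open>ki = -ik = aj\<close>.
\<close>

definition quat_mult :: "int \<Rightarrow> int \<Rightarrow> quat \<Rightarrow> quat \<Rightarrow> quat" where
  "quat_mult a b x y = Quat
     (qre x * qre y - a * qi x * qi y - b * qj x * qj y - a * b * qk x * qk y)
     (qre x * qi y + qi x * qre y + b * (qj x * qk y - qk x * qj y))
     (qre x * qj y + qj x * qre y + a * (qk x * qi y - qi x * qk y))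
     (qre x * qk y + qk x * qre y + qi x * qj y - qj x * qi y)"

definition quat_add :: "quat \<Rightarrow> quat \<Rightarrow> quat" where
  "quat_add x y = Quat (qre x + qre y) (qi x + qi y) (qj x + qj y) (qk x + qk y)"

definition LQ :: "int \<Rightarrow> int \<Rightarrow> quat ring" where
  "LQ a b = \<lparr>carrier = UNIV, mult = quat_mult a b, one = Quat 1 0 0 0,
             zero = Quat 0 0 0 0, add = quat_add\<rparr>"

lemma LQ_simps [simp]:
  "carrier (LQ a b) = UNIV"
  "x \<otimes>\<^bsub>LQ a b\<^esub> y = quat_mult a b x y"
  "\<one>\<^bsub>LQ a b\<^esub> = Quat 1 0 0 0"
  "\<zero>\<^bsub>LQ a b\<^esub> = Quat 0 0 0 0"
  "x \<oplus>\<^bsub>LQ a b\<^esub> y = quat_add x y"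
  by (simp_all add: LQ_def)

lemma ring_LQ: "ring (LQ a b)"
proof (rule ringI)
  show "abelian_group (LQ a b)"
  proof (rule abelian_groupI)
    fix x assume "x \<in> carrier (LQ a b)"
    show "\<exists>y\<in>carrier (LQ a b). y \<oplus>\<^bsub>LQ a b\<^esub> x = \<zero>\<^bsub>LQ a b\<^esub>"
      by (rule bexI[of _ "Quat (- qre x) (- qi x) (- qj x) (- qk x)"]) (auto simp: quat_add_def)
  qed (auto simp: quat_add_def quat.expand)
  show "monoid (LQ a b)"
    by (rule monoidI) (auto simp: quat_mult_def algebra_simps quat.expand)
qed (auto simp: quat_add_def quat_mult_def algebra_simps)

lemma LQ_relations:
  fixes a b :: int
  defines "i \<equiv> Quat 0 1 0 0" and "j \<equiv> Quat 0 0 1 0" and "k \<equiv> Quat 0 0 0 1"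
  shows "i \<otimes>\<^bsub>LQ a b\<^esub> i = Quat (- a) 0 0 0"
    and "j \<otimes>\<^bsub>LQ a b\<^esub> j = Quat (- b) 0 0 0"
    and "i \<otimes>\<^bsub>LQ a b\<^esub> j = k"
    and "j \<otimes>\<^bsub>LQ a b\<^esub> i = \<ominus>\<^bsub>LQ a b\<^esub> k"
    and "k \<otimes>\<^bsub>LQ a b\<^esub> k = Quat (- (a * b)) 0 0 0"
proof -
  interpret ring "LQ a b" by (rule ring_LQ)
  have "\<ominus>\<^bsub>LQ a b\<^esub> k = Quat 0 0 0 (- 1)"
    by (rule minus_equality) (auto simp: k_def quat_add_def)
  then show "j \<otimes>\<^bsub>LQ a b\<^esub> i = \<ominus>\<^bsub>LQ a b\<^esub> k"
    by (simp add: i_def j_def quat_mult_def)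
qed (simp_all add: i_def j_def k_def quat_mult_def)

definition LQ_cubes :: "int \<Rightarrow> int \<Rightarrow> quat set" where
  "LQ_cubes a b = {x [^]\<^bsub>LQ a b\<^esub> (3::nat) | x. x \<in> carrier (LQ a b)}"

definition LQ3 :: "int \<Rightarrow> int \<Rightarrow> quat set" where
  "LQ3 a b = generate (add_monoid (LQ a b)) (LQ_cubes a b)"

definition sum_of_at_most_cubes :: "int \<Rightarrow> int \<Rightarrow> nat \<Rightarrow> quat \<Rightarrow> bool" where
  "sum_of_at_most_cubes a b g q \<longleftrightarrow>
     (\<exists>n\<le>g. \<exists>x. (\<forall>m<n. x m \<in> carrier (LQ a b)) \<and>
        q = (\<Oplus>\<^bsub>LQ a b\<^esub>m\<in>{..<n}. x m [^]\<^bsub>LQ a b\<^esub> (3::nat)))"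

definition cubes_suffice :: "int \<Rightarrow> int \<Rightarrow> nat \<Rightarrow> bool" where
  "cubes_suffice a b g \<longleftrightarrow> 0 < g \<and> (\<forall>q\<in>LQ3 a b. sum_of_at_most_cubes a b g q)"

text \<open>Only meaningful when some \<open>g\<close> with \<open>cubes_suffice a b g\<close> exists.\<close>

definition waring_g3 :: "int \<Rightarrow> int \<Rightarrow> nat" where
  "waring_g3 a b = (LEAST g. cubes_suffice a b g)"

end

theory Submission
  imports Defs "HOL-Number_Theory.Cong"
begin

text \<open>
  Write a quaternion as \<open>(t, v)\<close> with real part \<open>t\<close> and vector part \<open>v\<close> (\<open>scalar_vec\<close>), and let
  \<open>N(v) = -v\<^sup>2\<close> (\<open>vnorm\<close>), with polar form \<open>2\<langle>_, _\<rangle>\<close> (\<open>vinner\<close>). Then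
  \<open>(t, v)\<^sup>3 = (t\<^sup>3 - 3tN(v), (3t\<^sup>2 - N(v))v)\<close>.

  The lower bounds are congruences modulo 9: the number 3 is never a sum of two cubes, and 4 is
  not a sum of three if 3 divides \<open>a\<close> and \<open>b\<close>. The upper bounds rest on the identity
  \<open>(\<xi>+1, g+w)\<^sup>3 + (\<xi>-1, w)\<^sup>3 - (\<xi>, g+w)\<^sup>3 - (\<xi>, w)\<^sup>3 = (6\<xi>(1+N(g)) - 3\<langle>g,u'\<rangle>, 3u')\<close> with
  \<open>u' = (2\<xi>+1)g + 2w\<close>, whose real part is linear in \<open>\<xi>\<close> once \<open>u'\<close> is fixed. For \<open>g = 0\<close> it
  represents every multiple of 6 by four cubes. If 3 does not divide both \<open>a\<close> and \<open>b\<close>, every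
  quaternion is a sum of two cubes modulo 6, and six cubes suffice.

  If 3 divides \<open>a\<close> and \<open>b\<close>, an element of the cube subgroup is \<open>q = (r, 3u)\<close>. If \<open>r + N(u)\<close>
  is odd, then \<open>q - q\<^sup>3\<close> is divisible by 6. Otherwise take \<open>g = Ku\<close> with \<open>K\<close> odd and subtract
  from \<open>q\<close> the cube of \<open>(m, mg + ce)\<close>, where \<open>e\<close> is orthogonal to \<open>u\<close>: modulo \<open>M = 1 + N(g)\<close>
  the remaining condition becomes \<open>r + 3KN(u) + 2mc\<^sup>2N(e) \<equiv> 0\<close>, linear in \<open>m\<close>. It is solvable
  if \<open>N(e)\<close> is prime to the odd part of \<open>M\<close> and the 2-part of \<open>2M\<close> divides \<open>r + 3KN(u)\<close>, and
  \<open>K\<close> can be chosen to ensure both.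
\<close>

section \<open>Quaternions as a lattice with a quadratic form\<close>

lemma quat_eq_iff: "x = y \<longleftrightarrow> qre x = qre y \<and> qi x = qi y \<and> qj x = qj y \<and> qk x = qk y"
  by (auto intro: quat.expand)

instantiation quat :: ab_group_add
begin

definition zero_quat where "0 = Quat 0 0 0 0"
definition plus_quat where "x + y = quat_add x y"
definition uminus_quat where "- x = Quat (- qre x) (- qi x) (- qj x) (- qk x)"
definition minus_quat where
  "x - y = Quat (qre x - qre y) (qi x - qi y) (qj x - qj y) (qk x - qk y)"

instance
  by standard
    (simp_all add: zero_quat_def plus_quat_def uminus_quat_def minus_quat_def quat_add_def)

end

lemma quat_zero_sel [simp]: "qre 0 = 0" "qi 0 = 0" "qj 0 = 0" "qk 0 = 0"
  by (simp_all add: zero_quat_def)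

lemma quat_plus_sel [simp]:
  "qre (x + y) = qre x + qre y" "qi (x + y) = qi x + qi y"
  "qj (x + y) = qj x + qj y" "qk (x + y) = qk x + qk y"
  by (simp_all add: plus_quat_def quat_add_def)

lemma quat_uminus_sel [simp]:
  "qre (- x) = - qre x" "qi (- x) = - qi x" "qj (- x) = - qj x" "qk (- x) = - qk x"
  by (simp_all add: uminus_quat_def)

lemma quat_minus_sel [simp]:
  "qre (x - y) = qre x - qre y" "qi (x - y) = qi x - qi y"
  "qj (x - y) = qj x - qj y" "qk (x - y) = qk x - qk y"
  by (simp_all add: minus_quat_def)

definition quat_scale :: "int \<Rightarrow> quat \<Rightarrow> quat" (infixr \<open>*q\<close> 75) where
  "c *q x = Quat (c * qre x) (c * qi x) (c * qj x) (c * qk x)"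

lemma quat_scale_sel [simp]:
  "qre (c *q x) = c * qre x" "qi (c *q x) = c * qi x"
  "qj (c *q x) = c * qj x" "qk (c *q x) = c * qk x"
  by (simp_all add: quat_scale_def)

definition scalar_vec :: "int \<Rightarrow> quat \<Rightarrow> quat" where
  "scalar_vec t v = Quat t (qi v) (qj v) (qk v)"

lemma scalar_vec_sel [simp]:
  "qre (scalar_vec t v) = t" "qi (scalar_vec t v) = qi v"
  "qj (scalar_vec t v) = qj v" "qk (scalar_vec t v) = qk v"
  by (simp_all add: scalar_vec_def)

lemma scalar_vec_qre [simp]: "scalar_vec (qre x) x = x"
  by (simp add: quat_eq_iff)

definition vinner :: "int \<Rightarrow> int \<Rightarrow> quat \<Rightarrow> quat \<Rightarrow> int" where
  "vinner a b x y = a * qi x * qi y + b * qj x * qj y + a * b * qk x * qk y"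

definition vnorm :: "int \<Rightarrow> int \<Rightarrow> quat \<Rightarrow> int" where
  "vnorm a b x = vinner a b x x"

lemma vinner_add_right: "vinner a b z (x + y) = vinner a b z x + vinner a b z y"
  and vinner_diff_right: "vinner a b z (x - y) = vinner a b z x - vinner a b z y"
  and vinner_scale_left: "vinner a b (c *q x) z = c * vinner a b x z"
  and vinner_scale_right: "vinner a b z (c *q x) = c * vinner a b z x"
  by (simp_all add: vinner_def algebra_simps)

lemma vnorm_add: "vnorm a b (x + y) = vnorm a b x + 2 * vinner a b x y + vnorm a b y"
  by (simp add: vnorm_def vinner_def algebra_simps)

lemma vnorm_diff: "vnorm a b (x - y) = vnorm a b x - 2 * vinner a b x y + vnorm a b y"
  by (simp add: vnorm_def vinner_def algebra_simps)

lemma vnorm_scale: "vnorm a b (c *q x) = c ^ 2 * vnorm a b x"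
  by (simp add: vnorm_def vinner_scale_left vinner_scale_right power2_eq_square)

lemma vnorm_zero [simp]: "vnorm a b 0 = 0"
  and vnorm_uminus [simp]: "vnorm a b (- x) = vnorm a b x"
  and vnorm_scalar_vec [simp]: "vnorm a b (scalar_vec t x) = vnorm a b x"
  by (simp_all add: vnorm_def vinner_def)

lemma vnorm_nonneg: "0 < a \<Longrightarrow> 0 < b \<Longrightarrow> 0 \<le> vnorm a b x"
  by (simp add: vnorm_def vinner_def mult.assoc)

lemma dvd_vnorm: "d dvd a \<Longrightarrow> d dvd b \<Longrightarrow> d dvd vnorm a b x"
  by (simp add: vnorm_def vinner_def)

lemma ex_orthogonal_vector:
  assumes "0 < a" "0 < b"
  shows "\<exists>e. vinner a b u e = 0 \<and> 0 < vnorm a b e"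
proof (cases "qi u = 0 \<and> qj u = 0")
  case True
  then show ?thesis
    using assms by (intro exI[of _ "Quat 0 1 0 0"]) (simp add: vinner_def vnorm_def)
next
  case False
  let ?e = "Quat 0 (b * qj u) (- a * qi u) 0"
  have "vnorm a b ?e = a * (b * qj u) ^ 2 + b * (a * qi u) ^ 2"
    by (simp add: vnorm_def vinner_def power2_eq_square)
  also have "0 < \<dots>"
    using False assms by (auto intro: add_pos_nonneg add_nonneg_pos)
  finally show ?thesis
    by (intro exI[of _ ?e]) (simp add: vinner_def)
qed

section \<open>Congruences between quaternions\<close>

definition qcong :: "int \<Rightarrow> quat \<Rightarrow> quat \<Rightarrow> bool" where
  "qcong m x y \<longleftrightarrow> [qre x = qre y] (mod m) \<and> [qi x = qi y] (mod m) \<and>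
     [qj x = qj y] (mod m) \<and> [qk x = qk y] (mod m)"

lemma qcong_refl [simp]: "qcong m x x"
  by (simp add: qcong_def)

lemma qcong_sym: "qcong m x y \<Longrightarrow> qcong m y x"
  by (simp add: qcong_def cong_sym_eq)

lemma qcong_trans: "qcong m x y \<Longrightarrow> qcong m y z \<Longrightarrow> qcong m x z"
  unfolding qcong_def by (meson cong_trans)

lemma qcong_add: "qcong m x x' \<Longrightarrow> qcong m y y' \<Longrightarrow> qcong m (x + y) (x' + y')"
  by (simp add: qcong_def cong_add)

lemma qcong_scale: "[c = d] (mod m) \<Longrightarrow> qcong m x y \<Longrightarrow> qcong m (c *q x) (d *q y)"
  by (simp add: qcong_def cong_mult)

lemma qcong_scalar_vec:
  "[s = t] (mod m) \<Longrightarrow> qcong m x y \<Longrightarrow> qcong m (scalar_vec s x) (scalar_vec t y)"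
  by (simp add: qcong_def)

lemma vnorm_cong: "qcong m x y \<Longrightarrow> [vnorm a b x = vnorm a b y] (mod m)"
  unfolding qcong_def vnorm_def vinner_def by (auto intro!: cong_add cong_mult)

lemma qcong_imp_ex_scale:
  assumes "qcong m x y"
  shows "\<exists>d. x = y + m *q d"
proof -
  have "m dvd qre x - qre y" "m dvd qi x - qi y" "m dvd qj x - qj y" "m dvd qk x - qk y"
    using assms by (simp_all add: qcong_def cong_iff_dvd_diff)
  then obtain d0 d1 d2 d3 where "qre x - qre y = m * d0" "qi x - qi y = m * d1"
    "qj x - qj y = m * d2" "qk x - qk y = m * d3"
    by (auto elim!: dvdE)
  then show ?thesis
    by (intro exI[of _ "Quat d0 d1 d2 d3"]) (simp add: quat_eq_iff algebra_simps)
qed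

lemma qcong_coprime_mult:
  "qcong m x y \<Longrightarrow> qcong n x y \<Longrightarrow> coprime m n \<Longrightarrow> qcong (m * n) x y"
  by (simp add: qcong_def coprime_cong_mult)

lemma qcong_chinese_remainder:
  assumes "coprime m n"
  shows "\<exists>z. qcong m z x \<and> qcong n z y"
proof -
  note crt = binary_chinese_remainder_int[OF assms]
  from crt[of "qre x" "qre y"] crt[of "qi x" "qi y"] crt[of "qj x" "qj y"] crt[of "qk x" "qk y"]
  obtain z0 z1 z2 z3 where
    "[z0 = qre x] (mod m)" "[z0 = qre y] (mod n)" "[z1 = qi x] (mod m)" "[z1 = qi y] (mod n)"
    "[z2 = qj x] (mod m)" "[z2 = qj y] (mod n)" "[z3 = qk x] (mod m)" "[z3 = qk y] (mod n)"
    by blast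
  then show ?thesis
    by (intro exI[of _ "Quat z0 z1 z2 z3"]) (simp add: qcong_def)
qed

section \<open>Sums of cubes\<close>

definition qcube :: "int \<Rightarrow> int \<Rightarrow> quat \<Rightarrow> quat" where
  "qcube a b x =
     scalar_vec (qre x ^ 3 - 3 * qre x * vnorm a b x) ((3 * qre x ^ 2 - vnorm a b x) *q x)"

lemma LQ_cube: "x [^]\<^bsub>LQ a b\<^esub> (3::nat) = qcube a b x"
proof -
  interpret ring "LQ a b" by (rule ring_LQ)
  have "x [^]\<^bsub>LQ a b\<^esub> (3::nat) = quat_mult a b (quat_mult a b x x) x"
    by (simp add: numeral_3_eq_3 quat_mult_def)
  then show ?thesis
    by (simp add: quat_eq_iff quat_mult_def qcube_def vnorm_def vinner_def algebra_simps
        power2_eq_square power3_eq_cube)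
qed

lemma qcube_zero [simp]: "qcube a b 0 = 0"
  by (simp add: qcube_def quat_eq_iff)

lemma qcube_uminus [simp]: "qcube a b (- x) = - qcube a b x"
  by (simp add: qcube_def quat_eq_iff)

lemma qcube_one [simp]: "qcube a b (scalar_vec 1 0) = scalar_vec 1 0"
  by (simp add: qcube_def quat_eq_iff)

lemma qcong_qcube: "qcong m x y \<Longrightarrow> qcong m (qcube a b x) (qcube a b y)"
  unfolding qcube_def
  by (intro qcong_scalar_vec qcong_scale cong_diff cong_mult cong_pow vnorm_cong cong_refl)
    (auto simp: qcong_def)

lemma finsum_LQ: "finsum (LQ a b) f A = sum f A"
proof -
  interpret ring "LQ a b" by (rule ring_LQ)
  show ?thesis
    by (induction A rule: infinite_finite_induct) (simp_all add: zero_quat_def plus_quat_def)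
qed

lemma sum_of_at_most_cubes_iff:
  "sum_of_at_most_cubes a b g q \<longleftrightarrow> (\<exists>zs. length zs = g \<and> q = (\<Sum>z\<leftarrow>zs. qcube a b z))"
proof
  assume "sum_of_at_most_cubes a b g q"
  then obtain n x where n: "n \<le> g" and q: "q = (\<Sum>m<n. qcube a b (x m))"
    by (auto simp: sum_of_at_most_cubes_def LQ_cube finsum_LQ)
  define zs where "zs = map (\<lambda>m. if m < n then x m else 0) [0..<g]"
  have "(\<Sum>z\<leftarrow>zs. qcube a b z) = (\<Sum>m\<in>{0..<g}. if m < n then qcube a b (x m) else 0)"
    by (auto simp: zs_def comp_def interv_sum_list_conv_sum_set_nat intro: sum.cong)
  also have "\<dots> = (\<Sum>m<n. qcube a b (x m))"
    using n by (intro sum.mono_neutral_cong_right) auto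
  finally show "\<exists>zs. length zs = g \<and> q = (\<Sum>z\<leftarrow>zs. qcube a b z)"
    using q by (intro exI[of _ zs]) (simp add: zs_def)
next
  assume "\<exists>zs. length zs = g \<and> q = (\<Sum>z\<leftarrow>zs. qcube a b z)"
  then obtain zs where "length zs = g" "q = (\<Sum>m<g. qcube a b (zs ! m))"
    by (auto simp: sum_list_sum_nth atLeast0LessThan)
  then show "sum_of_at_most_cubes a b g q"
    by (auto simp: sum_of_at_most_cubes_def LQ_cube finsum_LQ)
qed

lemma sum_of_at_most_cubes_add:
  "sum_of_at_most_cubes a b g x \<Longrightarrow> sum_of_at_most_cubes a b h y \<Longrightarrow>
     sum_of_at_most_cubes a b (g + h) (x + y)"
  unfolding sum_of_at_most_cubes_iff by (metis length_append map_append sum_list_append)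

lemma sum_of_at_most_cubes_mono:
  "sum_of_at_most_cubes a b g q \<Longrightarrow> g \<le> h \<Longrightarrow> sum_of_at_most_cubes a b h q"
  unfolding sum_of_at_most_cubes_def using le_trans by blast

lemma sum_of_at_most_cubes_qcube: "sum_of_at_most_cubes a b 1 (qcube a b z)"
  unfolding sum_of_at_most_cubes_iff by (intro exI[of _ "[z]"]) simp

lemma sum_of_at_most_cubes_of_nat: "sum_of_at_most_cubes a b n (scalar_vec (int n) 0)"
proof (induction n)
  case 0
  show ?case by (simp add: sum_of_at_most_cubes_iff quat_eq_iff)
next
  case (Suc n)
  have "scalar_vec (int (Suc n)) 0 = scalar_vec 1 0 + scalar_vec (int n) 0"
    by (simp add: quat_eq_iff)
  then show ?case
    using sum_of_at_most_cubes_add[OF sum_of_at_most_cubes_qcube[of a b "scalar_vec 1 0"] Suc]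
    by simp
qed

lemma sum_of_at_most_cubes_imp_LQ3:
  assumes "sum_of_at_most_cubes a b g q"
  shows "q \<in> LQ3 a b"
proof -
  have "(\<Sum>z\<leftarrow>zs. qcube a b z) \<in> LQ3 a b" for zs
  proof (induction zs)
    case Nil
    show ?case
      using generate.one[of "add_monoid (LQ a b)"] by (simp add: LQ3_def zero_quat_def)
  next
    case (Cons z zs)
    have "qcube a b z \<in> LQ3 a b"
      unfolding LQ3_def by (rule generate.incl) (auto simp: LQ_cubes_def LQ_cube)
    then show ?case
      using Cons.IH generate.eng[of _ "add_monoid (LQ a b)"] by (simp add: LQ3_def plus_quat_def)
  qed
  then show ?thesis
    using assms by (auto simp: sum_of_at_most_cubes_iff)
qed

lemma of_nat_in_LQ3: "scalar_vec (int n) 0 \<in> LQ3 a b"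
  using sum_of_at_most_cubes_of_nat by (rule sum_of_at_most_cubes_imp_LQ3)

lemma waring_g3_le: "cubes_suffice a b g \<Longrightarrow> waring_g3 a b \<le> g"
  unfolding waring_g3_def by (rule Least_le)

lemma less_waring_g3:
  assumes "cubes_suffice a b g" "q \<in> LQ3 a b" "\<not> sum_of_at_most_cubes a b l q"
  shows "l < waring_g3 a b"
proof (rule ccontr)
  assume "\<not> l < waring_g3 a b"
  moreover have "cubes_suffice a b (waring_g3 a b)"
    unfolding waring_g3_def using assms(1) by (rule LeastI)
  then have "sum_of_at_most_cubes a b (waring_g3 a b) q"
    using assms(2) by (simp add: cubes_suffice_def)
  ultimately show False
    using assms(3) sum_of_at_most_cubes_mono by (metis not_less)
qed

section \<open>Four cubes\<close>

lemma sum_of_four_cubes_linear_real_part: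
  assumes "qcong 2 u g"
  shows "sum_of_at_most_cubes a b 4
    (scalar_vec (6 * \<xi> * (1 + vnorm a b g) - 3 * vinner a b g u) (3 *q u))"
proof -
  have "qcong 2 u ((2 * \<xi> + 1) *q g)"
    by (rule qcong_trans[OF assms]) (simp add: qcong_def cong_iff_dvd_diff algebra_simps)
  then obtain w where w: "u = (2 * \<xi> + 1) *q g + 2 *q w"
    using qcong_imp_ex_scale by blast
  let ?zs = "[scalar_vec (\<xi> + 1) (g + w), scalar_vec (\<xi> - 1) w,
    - scalar_vec \<xi> (g + w), - scalar_vec \<xi> w]"
  have "scalar_vec (6 * \<xi> * (1 + vnorm a b g) - 3 * vinner a b g u) (3 *q u) =
      (\<Sum>z\<leftarrow>?zs. qcube a b z)"
    by (simp add: quat_eq_iff qcube_def w vnorm_add vinner_add_right vinner_scale_right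
        vnorm_def[symmetric] power2_eq_square power3_eq_cube algebra_simps)
  then show ?thesis
    unfolding sum_of_at_most_cubes_iff by (intro exI[of _ ?zs]) simp
qed

lemma sum_of_four_cubes_scale_6: "sum_of_at_most_cubes a b 4 (6 *q x)"
proof -
  have "qcong 2 (2 *q x) 0"
    by (simp add: qcong_def cong_iff_dvd_diff)
  from sum_of_four_cubes_linear_real_part[OF this, of a b "qre x"]
  show ?thesis
    by (simp add: quat_scale_def scalar_vec_def vinner_def)
qed

lemma sum_of_at_most_cubes_add_4_if_qcong_6:
  assumes "sum_of_at_most_cubes a b g p" "qcong 6 p q"
  shows "sum_of_at_most_cubes a b (g + 4) q"
  using qcong_imp_ex_scale[OF qcong_sym[OF assms(2)]]
    sum_of_at_most_cubes_add[OF assms(1) sum_of_four_cubes_scale_6]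
  by auto

section \<open>Cubes modulo 2, 3, 6 and 9\<close>

lemma cong_cube_self_mod_3: "[t ^ 3 = t] (mod 3)" for t :: int
proof -
  have "t mod 3 = 0 \<or> t mod 3 = 1 \<or> t mod 3 = 2" by presburger
  then have "(t mod 3) ^ 3 mod 3 = t mod 3" by auto
  then show ?thesis by (simp add: cong_def power_mod)
qed

lemma cong_square_one_mod_3:
  fixes t :: int
  assumes "\<not> 3 dvd t"
  shows "[t ^ 2 = 1] (mod 3)"
proof -
  have "t mod 3 = 1 \<or> t mod 3 = 2" using assms by presburger
  then have "(t mod 3) ^ 2 mod 3 = 1" by auto
  then show ?thesis by (simp add: cong_def power_mod)
qed

lemma cube_mod_9_cases: "t ^ 3 mod 9 \<in> {0, 1, 8}" for t :: int
proof -
  have "t mod 9 \<in> {0, 1, 2, 3, 4, 5, 6, 7, 8}" by auto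
  then have "(t mod 9) ^ 3 mod 9 \<in> {0, 1, 8}" by auto
  then show ?thesis by (simp add: power_mod)
qed

lemma qcong_2_qcube_self:
  assumes "odd (qre q + vnorm a b q)"
  shows "qcong 2 (qcube a b q) q"
proof -
  have "even (qre q ^ 3 - 3 * qre q * vnorm a b q - qre q)" using assms by auto
  moreover have "even ((3 * qre q ^ 2 - vnorm a b q) * w - w)" for w using assms by auto
  ultimately show ?thesis by (simp add: qcong_def qcube_def cong_iff_dvd_diff)
qed

lemma ex_two_qcubes_qcong_2: "\<exists>x y. qcong 2 (qcube a b x + qcube a b y) q"
proof (cases "odd (qre q + vnorm a b q)")
  case True
  then have "qcong 2 (qcube a b q + qcube a b 0) q"
    using qcong_2_qcube_self by simp
  then show ?thesis by blast
next
  case False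
  define p where "p = scalar_vec (qre q - 1) q"
  have "odd (qre p + vnorm a b p)" using False by (simp add: p_def)
  then have "qcong 2 (qcube a b p + qcube a b (scalar_vec 1 0)) (p + scalar_vec 1 0)"
    by (intro qcong_add qcong_2_qcube_self) simp_all
  also have "p + scalar_vec 1 0 = q" by (simp add: p_def quat_eq_iff)
  finally show ?thesis by blast
qed

lemma qcong_3_qcube_self:
  assumes "qcong 3 q (scalar_vec (qre q) 0)"
  shows "qcong 3 (qcube a b q) q"
proof -
  let ?r = "scalar_vec (qre q) 0"
  have "qcong 3 (qcube a b q) (qcube a b ?r)" using assms by (rule qcong_qcube)
  moreover have "qcong 3 (qcube a b ?r) ?r"
    using cong_cube_self_mod_3 by (simp add: qcube_def qcong_def vnorm_def vinner_def)
  ultimately show ?thesis using assms by (meson qcong_sym qcong_trans)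
qed

lemma ex_qcube_qcong_3:
  assumes "\<not> 3 dvd vnorm a b q"
  shows "\<exists>z. qcong 3 (qcube a b z) q"
proof
  define t N where "t = qre q" and "N = vnorm a b q"
  define z where "z = scalar_vec t ((- N) *q q)"
  have "vnorm a b z = N ^ 3"
    by (simp add: z_def vnorm_scale N_def power2_eq_square power3_eq_cube)
  then have cube: "qcube a b z =
      scalar_vec (t ^ 3 - 3 * t * N ^ 3) (((3 * t ^ 2 - N ^ 3) * - N) *q q)"
    by (simp add: qcube_def z_def quat_eq_iff)
  have "[t ^ 3 - 3 * t * N ^ 3 = t - 0] (mod 3)"
    by (intro cong_diff cong_cube_self_mod_3) (simp add: cong_def)
  moreover have "[(3 * t ^ 2 - N ^ 3) * - N = 1] (mod 3)"
  proof -
    have "(3 * t ^ 2 - N ^ 3) * - N = N ^ 2 * N ^ 2 - 3 * (t ^ 2 * N)"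
      by (simp add: power2_eq_square power3_eq_cube algebra_simps)
    also have "[\<dots> = 1 * 1 - 0] (mod 3)"
      using assms
      by (intro cong_diff cong_mult cong_square_one_mod_3) (simp_all add: cong_def N_def)
    finally show ?thesis by simp
  qed
  ultimately have "qcong 3 (qcube a b z) (scalar_vec t (1 *q q))"
    unfolding cube by (intro qcong_scalar_vec qcong_scale) simp_all
  also have "scalar_vec t (1 *q q) = q" by (simp add: quat_eq_iff t_def)
  finally show "qcong 3 (qcube a b z) q" .
qed

lemma ex_two_qcubes_qcong_3:
  assumes "\<not> 3 dvd vnorm a b e"
  shows "\<exists>x y. qcong 3 (qcube a b x + qcube a b y) q"
proof (cases "3 dvd vnorm a b q")
  case False
  then obtain x where "qcong 3 (qcube a b x + qcube a b 0) q"
    using ex_qcube_qcong_3 by fastforce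
  then show ?thesis by blast
next
  case True
  have "\<exists>d. \<not> 3 dvd vnorm a b d \<and> \<not> 3 dvd vnorm a b (q - d)"
  proof (cases "3 dvd vnorm a b (q - e)")
    case False
    then show ?thesis using assms by blast
  next
    case minus: True
    have "\<not> 3 dvd vnorm a b (q + e)"
    proof
      assume "3 dvd vnorm a b (q + e)"
      with minus True have "3 dvd vnorm a b (q - e) + vnorm a b (q + e) - 2 * vnorm a b q"
        by (intro dvd_add dvd_diff dvd_mult)
      then have "3 dvd 2 * vnorm a b e" by (simp add: vnorm_add vnorm_diff)
      with assms show False by presburger
    qed
    then show ?thesis using assms by (intro exI[of _ "- e"]) simp
  qed
  then obtain d where "\<not> 3 dvd vnorm a b d" "\<not> 3 dvd vnorm a b (q - d)" by blast
  then obtain x y where "qcong 3 (qcube a b x) d" "qcong 3 (qcube a b y) (q - d)"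
    using ex_qcube_qcong_3 by meson
  then have "qcong 3 (qcube a b x + qcube a b y) (d + (q - d))" by (rule qcong_add)
  then show ?thesis by auto
qed

lemma ex_two_qcubes_qcong_6:
  assumes "\<not> 3 dvd a \<or> \<not> 3 dvd b"
  shows "\<exists>x y. qcong 6 (qcube a b x + qcube a b y) q"
proof -
  obtain e where "\<not> 3 dvd vnorm a b e"
  proof
    show "\<not> 3 dvd vnorm a b (if 3 dvd a then Quat 0 0 1 0 else Quat 0 1 0 0)"
      using assms by (simp add: vnorm_def vinner_def)
  qed
  then obtain y1 y2 where y: "qcong 3 (qcube a b y1 + qcube a b y2) q"
    using ex_two_qcubes_qcong_3 by blast
  obtain x1 x2 where x: "qcong 2 (qcube a b x1 + qcube a b x2) q"
    using ex_two_qcubes_qcong_2 by blast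
  have "coprime 2 (3 :: int)" by simp
  then obtain z1 z2 where z: "qcong 2 z1 x1" "qcong 3 z1 y1" "qcong 2 z2 x2" "qcong 3 z2 y2"
    using qcong_chinese_remainder by meson
  let ?p = "qcube a b z1 + qcube a b z2"
  have "qcong 2 ?p q"
    using qcong_trans[OF _ x] z by (blast intro: qcong_add qcong_qcube)
  moreover have "qcong 3 ?p q"
    using qcong_trans[OF _ y] z by (blast intro: qcong_add qcong_qcube)
  ultimately have "qcong (2 * 3) ?p q"
    by (rule qcong_coprime_mult) simp
  then show ?thesis by auto
qed

lemma sum_of_six_cubes:
  assumes "\<not> 3 dvd a \<or> \<not> 3 dvd b"
  shows "sum_of_at_most_cubes a b 6 q"
proof -
  obtain x y where "qcong 6 (qcube a b x + qcube a b y) q"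
    using ex_two_qcubes_qcong_6[OF assms] by blast
  moreover have "sum_of_at_most_cubes a b (1 + 1) (qcube a b x + qcube a b y)"
    by (intro sum_of_at_most_cubes_add sum_of_at_most_cubes_qcube)
  ultimately show ?thesis
    using sum_of_at_most_cubes_add_4_if_qcong_6 by fastforce
qed

section \<open>The multiplier\<close>

lemma linear_cong_solvable:
  fixes a n c :: int
  assumes "coprime a n"
  shows "\<exists>x. [a * x = c] (mod n)"
proof -
  obtain x where "[a * x = 1] (mod n)"
    using cong_solve_coprime_int[OF assms] by blast
  then have "[a * x * c = 1 * c] (mod n)" by (rule cong_scalar_right)
  then show ?thesis by (intro exI[of _ "x * c"]) (simp add: mult.assoc)
qed

lemma linear_congs_solvable:
  fixes a b c d m n :: int
  assumes "coprime a m" "coprime b n" "coprime m n"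
  shows "\<exists>x. [a * x = c] (mod m) \<and> [b * x = d] (mod n)"
proof -
  obtain y z where y: "[a * y = c] (mod m)" and z: "[b * z = d] (mod n)"
    using assms(1,2) linear_cong_solvable by meson
  obtain x where x: "[x = y] (mod m)" "[x = z] (mod n)"
    using binary_chinese_remainder_int[OF assms(3)] by blast
  have "[a * x = c] (mod m)" "[b * x = d] (mod n)"
    using cong_trans[OF cong_scalar_left y] cong_trans[OF cong_scalar_left z] x by blast+
  then show ?thesis by blast
qed

lemma power_multiplicity_dvd:
  fixes p x y :: "'a :: factorial_semiring"
  assumes "p ^ j dvd x" "\<not> p ^ Suc j dvd y"
  shows "p ^ multiplicity p y dvd x"
proof -
  have "multiplicity p y \<le> j"
    using assms(2) multiplicity_dvd'[of "Suc j" p y] by linarith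
  then show ?thesis
    using assms(1) by (meson dvd_trans le_imp_power_dvd)
qed

lemma dvd_nine_mult_plus_square:
  fixes d K N r :: int
  assumes "d dvd 1 + K ^ 2 * N" "d dvd r + 3 * K * N"
  shows "d dvd 9 * N + r ^ 2"
proof -
  have "d dvd (1 + K ^ 2 * N) * (9 * N) + (r + 3 * K * N) * (r - 3 * K * N)"
    using assms by (rule dvd_add[OF dvd_mult2 dvd_mult2])
  also have "\<dots> = 9 * N + r ^ 2" by (simp add: algebra_simps power2_eq_square)
  finally show ?thesis .
qed

lemma ex_odd_multiplier:
  fixes N P r :: int
  assumes "0 \<le> N" "odd P" "even (r + N)"
  shows "\<exists>K. odd K \<and> P dvd K \<and> 2 ^ multiplicity 2 (2 * (1 + K ^ 2 * N)) dvd r + 3 * K * N"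
proof (cases "even N")
  case True
  then have "2 ^ 1 dvd r + 3 * P * N" using assms(3) by simp
  moreover have "\<not> 2 ^ Suc 1 dvd 2 * (1 + P ^ 2 * N)"
    using True by (simp only: power_Suc dvd_mult_cancel_left) simp
  ultimately have "2 ^ multiplicity 2 (2 * (1 + P ^ 2 * N)) dvd r + 3 * P * N"
    by (rule power_multiplicity_dvd)
  then show ?thesis using assms(2) by (intro exI[of _ P]) simp
next
  case False
  \<comment> \<open>Making \<open>r + 3KN\<close> divisible by a large power of 2 bounds the 2-part of \<open>1 + K\<^sup>2N\<close>.\<close>
  define B where "B = 9 * N + r ^ 2"
  have "0 < N" using assms(1) False by (cases "N = 0") auto
  then have "0 < B" by (simp add: B_def add_pos_nonneg)
  then obtain j where j: "B = int j" by (metis nonneg_int_cases less_imp_le)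
  then have "B < 2 ^ j" by (simp add: less_exp)
  then have not_dvd: "\<not> 2 ^ j dvd B" using \<open>0 < B\<close> zdvd_imp_le by fastforce
  have "coprime (3 * P * N) (2 ^ j)" using False assms(2) by simp
  then obtain x where "[3 * P * N * x = - r] (mod 2 ^ j)" using linear_cong_solvable by blast
  moreover define K where "K = P * x"
  ultimately have power_dvd: "2 ^ j dvd r + 3 * K * N"
    by (simp add: cong_iff_dvd_diff ac_simps)
  moreover have "0 < j" using \<open>0 < B\<close> j by simp
  ultimately have "even (r + 3 * K * N)" using dvd_power[of j "2::int"] dvd_trans by blast
  then have "odd K" using False assms(3) by auto
  moreover have "\<not> 2 ^ Suc j dvd 2 * (1 + K ^ 2 * N)"
  proof
    assume "2 ^ Suc j dvd 2 * (1 + K ^ 2 * N)"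
    then have "2 ^ j dvd 1 + K ^ 2 * N" by (simp only: power_Suc dvd_mult_cancel_left) simp
    then show False
      using dvd_nine_mult_plus_square[OF _ power_dvd] not_dvd by (simp add: B_def)
  qed
  ultimately show ?thesis
    using power_multiplicity_dvd[OF power_dvd] by (intro exI[of _ K]) (simp add: K_def)
qed

lemma coprime_one_plus_mult:
  fixes P K x :: int
  assumes "P dvd K"
  shows "coprime P (1 + K * x)"
proof (rule coprimeI)
  fix d assume "d dvd P" "d dvd 1 + K * x"
  moreover from this have "d dvd K * x" using assms by (meson dvd_mult2 dvd_trans)
  ultimately show "is_unit d" by (simp add: dvd_add_left_iff)
qed

lemma coprime_if_odd_dvd_one_plus_mult:
  fixes P K x M :: int
  assumes "P dvd K" "odd P" "odd M" "M dvd 2 * (1 + K * x)"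
  shows "coprime (2 ^ i * P) M"
proof -
  have "coprime P (2 * (1 + K * x))"
    using assms(2) coprime_one_plus_mult[OF assms(1)] by (simp only: coprime_mult_right_iff) simp
  then have "coprime P M"
    using assms(4) by (rule coprime_divisors[OF dvd_refl, rotated])
  then show ?thesis using assms(3) by simp
qed

lemma ex_odd_multiplier_coprime:
  fixes N E r :: int
  assumes "0 \<le> N" "0 < E" "even (r + N)"
  shows "\<exists>K. odd K \<and> 2 ^ multiplicity 2 (2 * (1 + K ^ 2 * N)) dvd r + 3 * K * N \<and>
    (\<forall>M. odd M \<longrightarrow> M dvd 2 * (1 + K ^ 2 * N) \<longrightarrow> coprime E M)"
proof -
  obtain P where P: "E = 2 ^ multiplicity 2 E * P" "odd P"
    using multiplicity_decompose'[of E 2] assms(2) by auto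
  obtain K where K: "odd K" "P dvd K"
    and two_part: "2 ^ multiplicity 2 (2 * (1 + K ^ 2 * N)) dvd r + 3 * K * N"
    using ex_odd_multiplier[OF assms(1) P(2) assms(3)] by blast
  have "coprime E M" if "odd M" "M dvd 2 * (1 + K ^ 2 * N)" for M
    using coprime_if_odd_dvd_one_plus_mult[OF K(2) P(2) that(1), of "K * N"] that(2) P(1)
    by (metis mult.assoc power2_eq_square)
  then show ?thesis using K(1) two_part by blast
qed

text \<open>
  With \<open>N = N(u)\<close>, \<open>E = N(e)\<close> and \<open>\<langle>u, e\<rangle> = 0\<close> this is \<open>r - Re(z\<^sup>3) + 3\<langle>g, u'\<rangle>\<close> for
  \<open>g = Ku\<close>, \<open>z = (m, mg + ce)\<close> and \<open>(r, 3u) - z\<^sup>3 = (r - Re(z\<^sup>3), 3u')\<close>.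
\<close>
definition real_defect :: "int \<Rightarrow> int \<Rightarrow> int \<Rightarrow> int \<Rightarrow> int \<Rightarrow> int \<Rightarrow> int" where
  "real_defect r N E K m c = r + 3 * K * N + 2 * m * c ^ 2 * E +
     (1 + K ^ 2 * N) * m * (m ^ 2 * K ^ 2 * N + c ^ 2 * E - m ^ 2)"

lemma three_dvd_real_defect:
  assumes "3 dvd N" "3 dvd E" "[m = r] (mod 3)"
  shows "3 dvd real_defect r N E K m c"
proof -
  have N: "[N = 0] (mod 3)" and E: "[E = 0] (mod 3)" using assms by (simp_all add: cong_0_iff)
  have "[real_defect r N E K m c = m + 3 * K * 0 + 2 * m * c ^ 2 * 0 +
      (1 + K ^ 2 * 0) * m * (m ^ 2 * K ^ 2 * 0 + c ^ 2 * 0 - m ^ 2)] (mod 3)"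
    unfolding real_defect_def
    by (intro cong_add cong_mult cong_diff cong_refl N E cong_sym[OF assms(3)])
  moreover have "3 dvd m - m ^ 3"
    using cong_cube_self_mod_3[of m, THEN cong_sym] by (simp add: cong_iff_dvd_diff)
  ultimately show ?thesis
    by (simp add: cong_dvd_iff power2_eq_square power3_eq_cube mult.assoc)
qed

lemma dvd_real_defect:
  assumes "even m" "2 * (1 + K ^ 2 * N) dvd r + 3 * K * N + 2 * m * c ^ 2 * E"
  shows "2 * (1 + K ^ 2 * N) dvd real_defect r N E K m c"
proof -
  have "2 * (1 + K ^ 2 * N) dvd (1 + K ^ 2 * N) * m"
    using mult_dvd_mono[OF assms(1) dvd_refl] by (metis mult.commute)
  with assms(2) show ?thesis
    unfolding real_defect_def by (rule dvd_add[OF _ dvd_mult2])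
qed

lemma coprime_3_two_mult_one_plus_square:
  fixes K N :: int
  assumes "3 dvd N"
  shows "coprime 3 (2 * (1 + K ^ 2 * N))"
  using coprime_one_plus_mult[OF assms, of "K ^ 2"]
  by (simp only: coprime_mult_right_iff mult.commute) simp

lemma six_mult_dvd_real_defect:
  assumes "3 dvd N" "3 dvd E" "[m = r] (mod 3)" "even m"
    and "2 * (1 + K ^ 2 * N) dvd r + 3 * K * N + 2 * m * c ^ 2 * E"
  shows "6 * (1 + K ^ 2 * N) dvd real_defect r N E K m c"
proof -
  have "3 * (2 * (1 + K ^ 2 * N)) dvd real_defect r N E K m c"
    using three_dvd_real_defect[OF assms(1-3)] dvd_real_defect[OF assms(4,5)]
      coprime_3_two_mult_one_plus_square[OF assms(1)] by (rule divides_mult)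
  then show ?thesis by simp
qed

lemma ex_dvd_real_defect:
  fixes N E r :: int
  assumes "0 \<le> N" "3 dvd N" "0 < E" "3 dvd E" "even (r + N)"
  shows "\<exists>K c m. odd K \<and> even c \<and> even m \<and> 6 * (1 + K ^ 2 * N) dvd real_defect r N E K m c"
proof -
  obtain K where "odd K"
    and two_part: "2 ^ multiplicity 2 (2 * (1 + K ^ 2 * N)) dvd r + 3 * K * N"
    and odd_part: "\<And>M. odd M \<Longrightarrow> M dvd 2 * (1 + K ^ 2 * N) \<Longrightarrow> coprime E M"
    using ex_odd_multiplier_coprime[OF assms(1,3,5)] by blast
  define D where "D = 2 * (1 + K ^ 2 * N)"
  define Q :: int where "Q = 2 ^ multiplicity 2 D"
  have "0 < D" using assms(1) by (simp add: D_def add_pos_nonneg)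
  then obtain M where M: "D = Q * M" "odd M"
    using multiplicity_decompose'[of D 2] by (auto simp: Q_def)
  have "even Q"
    using \<open>0 < D\<close> by (auto simp: Q_def multiplicity_gt_zero_iff D_def)
  have "coprime Q M" using M(2) by (simp add: Q_def)
  have "coprime E M"
    using odd_part[OF M(2)] by (simp only: M(1) dvd_triv_right flip: D_def)
  then have "coprime (2 * Q ^ 3 * E) M" using \<open>coprime Q M\<close> M(2) by simp
  moreover have "coprime Q 3" by (simp add: Q_def)
  moreover have "coprime M 3"
    using coprime_3_two_mult_one_plus_square[OF assms(2), of K]
    unfolding D_def[symmetric] M(1) by (simp add: coprime_commute)
  ultimately obtain m where
    m: "[2 * Q ^ 3 * E * m = - (r + 3 * K * N)] (mod M)" "[Q * m = r] (mod 3)"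
    using linear_congs_solvable by blast
  have "M dvd r + 3 * K * N + 2 * Q ^ 3 * E * m"
    using m(1) by (simp add: cong_iff_dvd_diff algebra_simps)
  moreover have "Q dvd r + 3 * K * N + 2 * Q ^ 3 * E * m"
    using two_part unfolding D_def[symmetric] Q_def[symmetric] by (simp add: power3_eq_cube)
  ultimately have "D dvd r + 3 * K * N + 2 * (Q * m) * Q ^ 2 * E"
    using \<open>coprime Q M\<close> unfolding M(1)
    by (simp add: divides_mult power2_eq_square power3_eq_cube ac_simps)
  then have "6 * (1 + K ^ 2 * N) dvd real_defect r N E K (Q * m) Q"
    using six_mult_dvd_real_defect[OF assms(2,4) m(2)] \<open>even Q\<close> by (simp only: D_def) simp
  then show ?thesis
    using \<open>odd K\<close> \<open>even Q\<close> by (intro exI[of _ K] exI[of _ Q] exI[of _ "Q * m"]) simp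
qed

section \<open>Five cubes\<close>

lemma sum_of_five_cubes_if_dvd_real_defect:
  fixes a b :: int and u e :: quat
  defines "N \<equiv> vnorm a b u" and "E \<equiv> vnorm a b e"
  assumes orth: "vinner a b u e = 0" and three: "3 dvd N" "3 dvd E"
    and par: "odd K" "even m" "even c"
    and defect: "6 * (1 + K ^ 2 * N) dvd real_defect r N E K m c"
  shows "sum_of_at_most_cubes a b 5 (scalar_vec r (3 *q u))"
proof -
  define g v where "g = K *q u" and "v = m *q g + c *q e"
  have vnorm_g: "vnorm a b g = K ^ 2 * N" by (simp add: g_def vnorm_scale N_def)
  have "vnorm a b v = m ^ 2 * K ^ 2 * N + c ^ 2 * E"
    using orth by (simp add: v_def g_def vnorm_add vnorm_scale vinner_scale_left
        vinner_scale_right N_def E_def)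
  moreover from this have "3 dvd vnorm a b v" using three by simp
  then obtain n where n: "vnorm a b v = 3 * n" by (elim dvdE)
  ultimately have vnorm_v: "m ^ 2 * K ^ 2 * N + c ^ 2 * E = 3 * n" by simp
  define u' where "u' = u - (m ^ 2 - n) *q v"
  have vinner_g_u': "vinner a b g u' = K * N - (m ^ 2 - n) * m * K ^ 2 * N"
    using orth by (simp add: u'_def v_def g_def vinner_diff_right vinner_add_right
        vinner_scale_left vinner_scale_right N_def vnorm_def power2_eq_square)
  have "qcong 2 u' g"
    using par by (simp add: u'_def v_def g_def qcong_def cong_iff_dvd_diff)
  obtain \<xi> where \<xi>: "real_defect r N E K m c = 6 * (1 + K ^ 2 * N) * \<xi>"
    using defect by (elim dvdE)
  let ?t = "6 * \<xi> * (1 + vnorm a b g) - 3 * vinner a b g u'"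
  have "real_defect r N E K m c = r + 3 * K * N + 2 * m * c ^ 2 * E +
      (1 + K ^ 2 * N) * m * (3 * n - m ^ 2)"
    by (simp add: real_defect_def vnorm_v)
  also have "2 * m * c ^ 2 * E = 2 * m * (3 * n - m ^ 2 * K ^ 2 * N)"
    by (simp add: vnorm_v[symmetric])
  finally have "r = m ^ 3 - 9 * m * n + ?t"
    unfolding \<xi> vnorm_g vinner_g_u' by (simp add: algebra_simps power2_eq_square power3_eq_cube)
  then have "scalar_vec r (3 *q u) = qcube a b (scalar_vec m v) + scalar_vec ?t (3 *q u')"
    by (simp add: quat_eq_iff qcube_def n u'_def algebra_simps)
  then show ?thesis
    using sum_of_at_most_cubes_add[OF sum_of_at_most_cubes_qcube
        sum_of_four_cubes_linear_real_part[OF \<open>qcong 2 u' g\<close>]] by simp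
qed

lemma sum_of_five_cubes:
  assumes "0 < a" "3 dvd a" "0 < b" "3 dvd b" and q: "qcong 3 q (scalar_vec (qre q) 0)"
  shows "sum_of_at_most_cubes a b 5 q"
proof (cases "odd (qre q + vnorm a b q)")
  case True
  have "qcong (2 * 3) (qcube a b q) q"
    using qcong_2_qcube_self[OF True] qcong_3_qcube_self[OF q] by (rule qcong_coprime_mult) simp
  then show ?thesis
    using sum_of_at_most_cubes_add_4_if_qcong_6[OF sum_of_at_most_cubes_qcube] by fastforce
next
  case False
  obtain u where "q = scalar_vec (qre q) 0 + 3 *q u"
    using qcong_imp_ex_scale[OF q] by blast
  then have q_eq: "q = scalar_vec (qre q) (3 *q u)"
    by (simp add: quat_eq_iff)
  have "vnorm a b q = 9 * vnorm a b u"
    using arg_cong[OF q_eq, of "vnorm a b"] by (simp add: vnorm_scale)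
  then have "even (qre q + vnorm a b u)" using False by simp
  obtain e where e: "vinner a b u e = 0" "0 < vnorm a b e"
    using ex_orthogonal_vector assms by blast
  obtain K c m where "odd K" "even c" "even m"
    "6 * (1 + K ^ 2 * vnorm a b u) dvd real_defect (qre q) (vnorm a b u) (vnorm a b e) K m c"
    using ex_dvd_real_defect[of "vnorm a b u" "vnorm a b e" "qre q"] vnorm_nonneg dvd_vnorm
      assms e \<open>even (qre q + vnorm a b u)\<close> by blast
  then have "sum_of_at_most_cubes a b 5 (scalar_vec (qre q) (3 *q u))"
    using sum_of_five_cubes_if_dvd_real_defect e(1) dvd_vnorm assms by blast
  then show ?thesis using q_eq by simp
qed

lemma LQ3_qcong_3_real:
  assumes "3 dvd a" "3 dvd b" "q \<in> LQ3 a b"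
  shows "qcong 3 q (scalar_vec (qre q) 0)"
proof -
  interpret ring "LQ a b" by (rule ring_LQ)
  have cube: "qcong 3 h (scalar_vec (qre h) 0)" if "h \<in> LQ_cubes a b" for h
  proof -
    from that obtain x where "h = qcube a b x" by (auto simp: LQ_cubes_def LQ_cube)
    moreover have "3 dvd 3 * qre x ^ 2 - vnorm a b x" using dvd_vnorm[OF assms(1,2)] by simp
    ultimately show ?thesis by (simp add: qcube_def qcong_def cong_0_iff)
  qed
  have uminus: "inv\<^bsub>add_monoid (LQ a b)\<^esub> h = - h" for h
    unfolding a_inv_def[symmetric]
    by (rule minus_equality) (simp_all flip: plus_quat_def zero_quat_def)
  from assms(3) show ?thesis
    unfolding LQ3_def
  proof (induction rule: generate.induct)
    case one
    show ?case by (simp flip: zero_quat_def) (simp add: qcong_def)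
  next
    case (incl h)
    then show ?case by (rule cube)
  next
    case (inv h)
    then show ?case using cube[of h] unfolding uminus by (simp add: qcong_def cong_0_iff)
  next
    case (eng x y)
    then show ?case by (simp add: qcong_def cong_0_iff flip: plus_quat_def)
  qed
qed

section \<open>Lower bounds\<close>

lemma vnorm_cong_if_qcube_sum_real:
  assumes "qcube a b y + qcube a b z = scalar_vec n 0"
  shows "[vnorm a b y = vnorm a b z] (mod 3)"
proof -
  define M N where "M = vnorm a b y" and "N = vnorm a b z"
  have "[M * v = - N * w] (mod 3)"
    if "(3 * qre y ^ 2 - M) * v + (3 * qre z ^ 2 - N) * w = 0" for v w
  proof -
    have "M * v - (- N * w) = 3 * (qre y ^ 2 * v + qre z ^ 2 * w)"
      using that by (simp add: algebra_simps)
    then show ?thesis by (simp add: cong_iff_dvd_diff)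
  qed
  then have "qcong 3 (scalar_vec 0 (M *q y)) (scalar_vec 0 ((- N) *q z))"
    using assms by (simp add: qcong_def quat_eq_iff qcube_def M_def N_def)
  then have "[vnorm a b (M *q y) = vnorm a b ((- N) *q z)] (mod 3)"
    using vnorm_cong by fastforce
  then have "[M ^ 3 = N ^ 3] (mod 3)"
    by (simp add: vnorm_scale M_def N_def power2_eq_square power3_eq_cube)
  then show ?thesis
    unfolding M_def N_def by (meson cong_cube_self_mod_3 cong_sym cong_trans)
qed

lemma nine_dvd_if_sum_of_two_cubes:
  assumes "sum_of_at_most_cubes a b 2 (scalar_vec n 0)" "3 dvd n"
  shows "9 dvd n"
proof -
  obtain y z where yz: "qcube a b y + qcube a b z = scalar_vec n 0"
    using assms(1) by (auto simp: sum_of_at_most_cubes_iff numeral_2_eq_2 length_Suc_conv)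
  define s t M N where "s = qre y" and "t = qre z" and "M = vnorm a b y" and "N = vnorm a b z"
  from yz have n: "n = s ^ 3 + t ^ 3 - 3 * (s * M + t * N)"
    by (simp add: quat_eq_iff qcube_def s_def t_def M_def N_def)
  have "[n = s + t - 0] (mod 3)" unfolding n
    by (intro cong_diff cong_add cong_cube_self_mod_3) (simp add: cong_def)
  then have "3 dvd s + t" using assms(2) by (simp add: cong_dvd_iff)
  moreover have "3 dvd s * (M - N) + (s + t) * N"
    using vnorm_cong_if_qcube_sum_real[OF yz] \<open>3 dvd s + t\<close>
    by (simp add: cong_iff_dvd_diff M_def N_def)
  ultimately obtain k l where "s + t = 3 * k" and "s * (M - N) + (s + t) * N = 3 * l"
    by (elim dvdE)
  moreover have "n = (s + t) ^ 3 - 3 * s * t * (s + t) - 3 * (s * (M - N) + (s + t) * N)"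
    by (simp add: n power3_eq_cube algebra_simps)
  ultimately have "n = 9 * (3 * k ^ 3 - s * t * k - l)" by (simp add: power_mult_distrib)
  then show ?thesis by simp
qed

lemma qre_qcube_mod_9:
  assumes "3 dvd a" "3 dvd b"
  shows "qre (qcube a b z) mod 9 \<in> {0, 1, 8}"
proof -
  obtain n where "vnorm a b z = 3 * n" using dvd_vnorm[OF assms] by blast
  then have "qre (qcube a b z) = qre z ^ 3 + 9 * (- qre z * n)" by (simp add: qcube_def)
  then show ?thesis using cube_mod_9_cases[of "qre z"] by (simp only: mod_mult_self2)
qed

lemma not_sum_of_three_cubes_if_4_mod_9:
  assumes "3 dvd a" "3 dvd b" "qre q mod 9 = 4"
  shows "\<not> sum_of_at_most_cubes a b 3 q"
proof
  assume "sum_of_at_most_cubes a b 3 q"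
  then obtain x y z where q: "q = qcube a b x + (qcube a b y + qcube a b z)"
    by (auto simp: sum_of_at_most_cubes_iff numeral_3_eq_3 length_Suc_conv)
  let ?\<rho> = "\<lambda>z. qre (qcube a b z) mod 9"
  have "[qre q = ?\<rho> x + (?\<rho> y + ?\<rho> z)] (mod 9)"
    unfolding q quat_plus_sel by (intro cong_add) (simp_all add: cong_def)
  moreover have "?\<rho> x \<in> {0, 1, 8}" "?\<rho> y \<in> {0, 1, 8}" "?\<rho> z \<in> {0, 1, 8}"
    using qre_qcube_mod_9[OF assms(1,2)] by blast+
  ultimately show False using assms(3) by (auto simp: cong_def)
qed

theorem mainTheorem1:
  fixes a b :: int
  assumes "a > 0" and "b > 0"
  shows "(\<exists>g. cubes_suffice a b g) \<and>
    (\<not> 3 dvd a \<or> \<not> 3 dvd b \<longrightarrow> 3 \<le> waring_g3 a b \<and> waring_g3 a b \<le> 6) \<and>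
    (3 dvd a \<and> 3 dvd b \<longrightarrow> 4 \<le> waring_g3 a b \<and> waring_g3 a b \<le> 5)"
proof (cases "3 dvd a \<and> 3 dvd b")
  case True
  then have suffice: "cubes_suffice a b 5"
    using assms by (auto simp: cubes_suffice_def intro: sum_of_five_cubes LQ3_qcong_3_real)
  have "\<not> sum_of_at_most_cubes a b 3 (scalar_vec 4 0)"
    using True by (simp add: not_sum_of_three_cubes_if_4_mod_9)
  then have "3 < waring_g3 a b"
    using less_waring_g3[OF suffice of_nat_in_LQ3[of 4]] by simp
  then show ?thesis using True suffice waring_g3_le[OF suffice] by auto
next
  case False
  then have suffice: "cubes_suffice a b 6"
    by (simp add: cubes_suffice_def sum_of_six_cubes)
  have "\<not> sum_of_at_most_cubes a b 2 (scalar_vec 3 0)"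
    using nine_dvd_if_sum_of_two_cubes[of a b 3] by auto
  then have "2 < waring_g3 a b"
    using less_waring_g3[OF suffice of_nat_in_LQ3[of 3]] by simp
  then show ?thesis using False suffice waring_g3_le[OF suffice] by auto
qed

end
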